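(* Let $\alpha_1,\alpha_2,\alpha_3\in\mathbb{C}$ satisfy $2\alpha_1+2\alpha_2+\alpha_3=1$, and consider the Hamiltonian system $\Sigma(\alpha_1,\alpha_2,\alpha_3)$ $$\frac{dx}{dt}=-2x^2+4y-3w-2t,\quad \frac{dy}{dt}=4xy+2\alpha_2,\quad \frac{dz}{dt}=z^2+2w-3y+t,\quad \frac{dw}{dt}=-2zw-\alpha_3.$$ Then this system is invariant under the following birational and symplectic transformations $s_1,s_2,s_3$. Write $f:=y-x^2-w-t$, $g:=x+z$. $$s_1:(x,y,z,w,t;\alpha_1,\alpha_2,\alpha_3)\mapsto\left(x+\frac{\alpha_2}{y},\,y,\,z,\,w,\,t;\ \alpha_1+2\alpha_2,\,-\alpha_2,\,\alpha_3\right),$$ $$s_2:(x,y,z,w,t;\alpha_1,\alpha_2,\alpha_3)\mapsto\left(x,\,y,\,z+\frac{\alpha_3}{w},\,w,\,t;\ \alpha_1+\alpha_3,\,\alpha_2,\,-\alpha_3\right),$$ $$s_3:(x,y,z,w,t;\alpha_1,\alpha_2,\alpha_3)\mapsto(X,Y,Z,W,t;\ -\alpha_1-\alpha_3,\ 2\alpha_1+\alpha_2+\alpha_3,\ \alpha_3),$$ where $$X=\frac{xf-gw+\alpha_1}{f},\qquad Y=y-x^2-w+\frac{(xf-gw+\alpha_1)^2}{f^2}-\frac{g(-1-gw+2\alpha_1+2\alpha_2)}{f},$$ $$Z=-\frac{f}{g}-\frac{xf-gw+\alpha_1}{f},\qquad W=-\frac{g(-1-gw+2\alpha_1+2\alp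ha_2)}{f}.$$
   Context: All variables are complex. The system $\Sigma(\alpha_1,\alpha_2,\alpha_3)$ is the Hamiltonian system $\frac{dx}{dt}=\frac{\partial H}{\partial y}$, $\frac{dy}{dt}=-\frac{\partial H}{\partial x}$, $\frac{dz}{dt}=\frac{\partial H}{\partial w}$, $\frac{dw}{dt}=-\frac{\partial H}{\partial z}$ with $H=-2x^2y+2y^2-2ty-2\alpha_2x+z^2w+w^2+tw+\alpha_3z-3yw$. "Invariant under a transformation $(x,y,z,w,t;\alpha)\mapsto(\tilde x,\tilde y,\tilde z,\tilde w,t;\tilde\alpha)$" means: the transformation carries solutions of $\Sigma(\alpha)$ (on which it is defined) to solutions of $\Sigma(\tilde\alpha)$. "Symplectic" means that for each fixed $t$ (and fixed parameters) the map preserves the 2-form $dx\wedge dy+dz\wedge dw$. *)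

theory Defs
  imports "HOL-Analysis.Analysis"
begin

section \<open>The Hamiltonian system\<close>

type_synonym params = "complex \<times> complex \<times> complex"

text \<open>A point of phase space is \<open>vector [x, y, z, w]\<close>; a point of the extended phase space
  is \<open>vector [x, y, z, w, t]\<close>.\<close>

type_synonym phase = "complex ^ 4"
type_synonym ext_phase = "complex ^ 5"

definition normalized :: "params \<Rightarrow> bool" where
  "normalized = (\<lambda>(\<alpha>1, \<alpha>2, \<alpha>3). 2 * \<alpha>1 + 2 * \<alpha>2 + \<alpha>3 = 1)"

definition ham :: "params \<Rightarrow> complex \<Rightarrow> complex \<Rightarrow> complex \<Rightarrow> complex \<Rightarrow> complex \<Rightarrow> complex" where
  "ham = (\<lambda>(\<alpha>1, \<alpha>2, \<alpha>3) t x y z w.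
     - 2 * x^2 * y + 2 * y^2 - 2 * t * y - 2 * \<alpha>2 * x
     + z^2 * w + w^2 + t * w + \<alpha>3 * z - 3 * y * w)"

text \<open>Holomorphic solutions on an arbitrary open set of complex times.\<close>

definition solution :: "params \<Rightarrow> complex set \<Rightarrow> (complex \<Rightarrow> phase) \<Rightarrow> bool" where
  "solution \<alpha> U u \<longleftrightarrow> open U \<and> (\<forall>t\<in>U.
     (let x = u t $ 1; y = u t $ 2; z = u t $ 3; w = u t $ 4 in
        ((\<lambda>s. u s $ 1) has_field_derivative deriv (\<lambda>\<eta>. ham \<alpha> t x \<eta> z w) y) (at t) \<and>
        ((\<lambda>s. u s $ 2) has_field_derivative - deriv (\<lambda>\<xi>. ham \<alpha> t \<xi> y z w) x) (at t) \<and>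
        ((\<lambda>s. u s $ 3) has_field_derivative deriv (\<lambda>\<omega>. ham \<alpha> t x y z \<omega>) w) (at t) \<and>
        ((\<lambda>s. u s $ 4) has_field_derivative - deriv (\<lambda>\<zeta>. ham \<alpha> t x y \<zeta> w) z) (at t)))"

lemma deriv_ham:
  "deriv (\<lambda>\<eta>. ham (\<alpha>1, \<alpha>2, \<alpha>3) t x \<eta> z w) y = - 2 * x^2 + 4 * y - 3 * w - 2 * t"
  "deriv (\<lambda>\<xi>. ham (\<alpha>1, \<alpha>2, \<alpha>3) t \<xi> y z w) x = - (4 * x * y + 2 * \<alpha>2)"
  "deriv (\<lambda>\<omega>. ham (\<alpha>1, \<alpha>2, \<alpha>3) t x y z \<omega>) w = z^2 + 2 * w - 3 * y + t"
  "deriv (\<lambda>\<zeta>. ham (\<alpha>1, \<alpha>2, \<alpha>3) t x y \<zeta> w) z = - (- 2 * z * w - \<alpha>3)"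
  unfolding ham_def split_conv
  by (rule DERIV_imp_deriv; (rule derivative_eq_intros refl | simp add: algebra_simps)+)+

lemma solution_iff:
  "solution (\<alpha>1, \<alpha>2, \<alpha>3) U u \<longleftrightarrow> open U \<and> (\<forall>t\<in>U.
     (let x = u t $ 1; y = u t $ 2; z = u t $ 3; w = u t $ 4 in
        ((\<lambda>s. u s $ 1) has_field_derivative - 2 * x^2 + 4 * y - 3 * w - 2 * t) (at t) \<and>
        ((\<lambda>s. u s $ 2) has_field_derivative 4 * x * y + 2 * \<alpha>2) (at t) \<and>
        ((\<lambda>s. u s $ 3) has_field_derivative z^2 + 2 * w - 3 * y + t) (at t) \<and>
        ((\<lambda>s. u s $ 4) has_field_derivative - 2 * z * w - \<alpha>3) (at t)))"
  unfolding solution_def Let_def deriv_ham minus_minus ..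


section \<open>Invariance\<close>

text \<open>A transformation is given by its action \<open>T\<close> on the phase variables, its action \<open>\<sigma>\<close> on the
  parameters, and the set \<open>D t\<close> of phase points at which it is defined at time \<open>t\<close> (no denominator
  vanishes); outside \<open>D t\<close> the value of \<open>T\<close> is irrelevant. The system with parameters \<open>\<sigma> \<alpha>\<close> is
  again of the same family only if \<open>\<sigma> \<alpha>\<close> satisfies the normalization; as the parameter \<open>\<alpha>1\<close>
  does not occur in the Hamiltonian, this is also what ties the first component of \<open>\<sigma> \<alpha>\<close> to the
  transformed system.\<close>

definition invariant_under ::
  "params \<Rightarrow> (complex \<Rightarrow> phase set) \<Rightarrow> (params \<Rightarrow> complex \<Rightarrow> phase \<Rightarrow> phase) \<Rightarrow> (params \<Rightarrow> params) \<Rightarrow> bool"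
where
  "invariant_under \<alpha> D T \<sigma> \<longleftrightarrow> normalized (\<sigma> \<alpha>) \<and>
     (\<forall>U u. solution \<alpha> U u \<and> (\<forall>t\<in>U. u t \<in> D t) \<longrightarrow> solution (\<sigma> \<alpha>) U (\<lambda>t. T \<alpha> t (u t)))"


section \<open>Symplectic maps\<close>

text \<open>The 2-form \<open>dx \<and> dy + dz \<and> dw\<close>.\<close>

definition symp_form :: "phase \<Rightarrow> phase \<Rightarrow> complex" where
  "symp_form u v = (u $ 1 * v $ 2 - u $ 2 * v $ 1) + (u $ 3 * v $ 4 - u $ 4 * v $ 3)"

text \<open>\<open>J\<close> is the complex Jacobian matrix of \<open>F\<close> at \<open>p\<close>.\<close>

definition symplectic_on :: "phase set \<Rightarrow> (phase \<Rightarrow> phase) \<Rightarrow> bool" where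
  "symplectic_on D F \<longleftrightarrow> (\<forall>p\<in>D. \<exists>J :: complex^4^4.
     (F has_derivative (\<lambda>v. J *v v)) (at p) \<and>
     (\<forall>u v. symp_form (J *v u) (J *v v) = symp_form u v))"


section \<open>Birational maps\<close>

text \<open>Complex polynomial functions; the library's polynomial functions of several variables are
  polynomials in the real coordinates.\<close>

inductive cpolynomial :: "(complex ^ 'n \<Rightarrow> complex) \<Rightarrow> bool" where
  const: "cpolynomial (\<lambda>p. c)"
| coord: "cpolynomial (\<lambda>p. p $ i)"
| add: "cpolynomial f \<Longrightarrow> cpolynomial g \<Longrightarrow> cpolynomial (\<lambda>p. f p + g p)"
| mult: "cpolynomial f \<Longrightarrow> cpolynomial g \<Longrightarrow> cpolynomial (\<lambda>p. f p * g p)"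

text \<open>The components of \<open>F\<close> are written with a common denominator \<open>Q\<close>, and \<open>D\<close> is the set where
  \<open>Q\<close> does not vanish. Nonemptiness of \<open>D\<close> says that \<open>Q\<close> is not the zero polynomial.\<close>

definition rational_on :: "(complex ^ 'n) set \<Rightarrow> (complex ^ 'n \<Rightarrow> complex ^ 'm) \<Rightarrow> bool" where
  "rational_on D F \<longleftrightarrow> (\<exists>P Q. (\<forall>i. cpolynomial (P i)) \<and> cpolynomial Q \<and>
     D = {p. Q p \<noteq> 0} \<and> D \<noteq> {} \<and> (\<forall>p\<in>D. \<forall>i. F p $ i = P i p / Q p))"

text \<open>There is a rational map \<open>G\<close> such that both composites are defined as rational maps (that is,
  at some point, hence on a nonempty Zariski open set) and are the identity where defined.\<close>

definition birational_on :: "(complex ^ 'n) set \<Rightarrow> (complex ^ 'n \<Rightarrow> complex ^ 'n) \<Rightarrow> bool" where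
  "birational_on D F \<longleftrightarrow> rational_on D F \<and> (\<exists>E G. rational_on E G \<and>
     (\<exists>p\<in>D. F p \<in> E) \<and> (\<forall>p\<in>D. F p \<in> E \<longrightarrow> G (F p) = p) \<and>
     (\<exists>q\<in>E. G q \<in> D) \<and> (\<forall>q\<in>E. G q \<in> D \<longrightarrow> F (G q) = q))"

definition phase_of :: "ext_phase \<Rightarrow> phase" where
  "phase_of q = vector [q $ 1, q $ 2, q $ 3, q $ 4]"

definition ext_dom :: "(complex \<Rightarrow> phase set) \<Rightarrow> ext_phase set" where
  "ext_dom D = {q. phase_of q \<in> D (q $ 5)}"

definition ext_map :: "(complex \<Rightarrow> phase \<Rightarrow> phase) \<Rightarrow> ext_phase \<Rightarrow> ext_phase" where
  "ext_map F q = (let p = F (q $ 5) (phase_of q) in vector [p $ 1, p $ 2, p $ 3, p $ 4, q $ 5])"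

text \<open>Birationality is required both in the variables \<open>(x, y, z, w, t)\<close> and, as for symplecticity,
  in \<open>(x, y, z, w)\<close> for each fixed \<open>t\<close>.\<close>

definition birational_transformation ::
  "(complex \<Rightarrow> phase set) \<Rightarrow> (complex \<Rightarrow> phase \<Rightarrow> phase) \<Rightarrow> bool" where
  "birational_transformation D F \<longleftrightarrow>
     birational_on (ext_dom D) (ext_map F) \<and> (\<forall>t. birational_on (D t) (F t))"

definition symplectic_transformation ::
  "(complex \<Rightarrow> phase set) \<Rightarrow> (complex \<Rightarrow> phase \<Rightarrow> phase) \<Rightarrow> bool" where
  "symplectic_transformation D F \<longleftrightarrow> (\<forall>t. symplectic_on (D t) (F t))"


section \<open>The three transformations\<close>

definition s1 :: "params \<Rightarrow> complex \<Rightarrow> phase \<Rightarrow> phase" where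
  "s1 = (\<lambda>(\<alpha>1, \<alpha>2, \<alpha>3) t p.
     let x = p $ 1; y = p $ 2; z = p $ 3; w = p $ 4
     in vector [x + \<alpha>2 / y, y, z, w])"

definition s1_dom :: "complex \<Rightarrow> phase set" where
  "s1_dom t = {p. p $ 2 \<noteq> 0}"

definition s1_par :: "params \<Rightarrow> params" where
  "s1_par = (\<lambda>(\<alpha>1, \<alpha>2, \<alpha>3). (\<alpha>1 + 2 * \<alpha>2, - \<alpha>2, \<alpha>3))"

definition s2 :: "params \<Rightarrow> complex \<Rightarrow> phase \<Rightarrow> phase" where
  "s2 = (\<lambda>(\<alpha>1, \<alpha>2, \<alpha>3) t p.
     let x = p $ 1; y = p $ 2; z = p $ 3; w = p $ 4
     in vector [x, y, z + \<alpha>3 / w, w])"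

definition s2_dom :: "complex \<Rightarrow> phase set" where
  "s2_dom t = {p. p $ 4 \<noteq> 0}"

definition s2_par :: "params \<Rightarrow> params" where
  "s2_par = (\<lambda>(\<alpha>1, \<alpha>2, \<alpha>3). (\<alpha>1 + \<alpha>3, \<alpha>2, - \<alpha>3))"

definition f3 :: "complex \<Rightarrow> phase \<Rightarrow> complex" where
  "f3 t p = p $ 2 - (p $ 1)^2 - p $ 4 - t"

definition g3 :: "phase \<Rightarrow> complex" where
  "g3 p = p $ 1 + p $ 3"

definition s3 :: "params \<Rightarrow> complex \<Rightarrow> phase \<Rightarrow> phase" where
  "s3 = (\<lambda>(\<alpha>1, \<alpha>2, \<alpha>3) t p.
     let x = p $ 1; y = p $ 2; z = p $ 3; w = p $ 4; f = f3 t p; g = g3 p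
     in vector
       [(x * f - g * w + \<alpha>1) / f,
        y - x^2 - w + (x * f - g * w + \<alpha>1)^2 / f^2
          - g * (- 1 - g * w + 2 * \<alpha>1 + 2 * \<alpha>2) / f,
        - (f / g) - (x * f - g * w + \<alpha>1) / f,
        - (g * (- 1 - g * w + 2 * \<alpha>1 + 2 * \<alpha>2) / f)])"

definition s3_dom :: "complex \<Rightarrow> phase set" where
  "s3_dom t = {p. f3 t p \<noteq> 0 \<and> g3 p \<noteq> 0}"

definition s3_par :: "params \<Rightarrow> params" where
  "s3_par = (\<lambda>(\<alpha>1, \<alpha>2, \<alpha>3). (- \<alpha>1 - \<alpha>3, 2 * \<alpha>1 + \<alpha>2 + \<alpha>3, \<alpha>3))"

end

theory Submission
  imports Defs
begin

text \<open>Each \<open>s1\<close>, \<open>s2\<close>, \<open>s3\<close> maps its domain bijectively onto itself at every time, and its inverse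
is the same formula with the transformed parameters. All components are rational, so
birationality needs only a polynomial common denominator whose nonvanishing set is the domain.

The maps \<open>s1\<close> and \<open>s2\<close> are shears: they add to one coordinate a function of the conjugate
coordinate only, which preserves the 2-form. They preserve the system because along
solutions the time derivative of
\<open>\<alpha>2 / y\<close> is exactly \<open>-2 * (X^2 - x^2)\<close> for \<open>X = x + \<alpha>2 / y\<close>, and that of \<open>\<alpha>3 / w\<close> is
\<open>Z^2 - z^2\<close> for \<open>Z = z + \<alpha>3 / w\<close>.

The map \<open>s3\<close> looks opaque in the original variables, but it keeps \<open>f = y - x^2 - w - t\<close>,
sends \<open>g = x + z\<close> to \<open>-f / g\<close> and, since \<open>-1 + 2 * \<alpha>1 + 2 * \<alpha>2 = -\<alpha>3\<close>, sends \<open>g * w\<close> to \<open>-(g * w + \<alpha>3)\<close>.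
Moreover
\<open>dx \<and> dy + dz \<and> dw = dx \<and> df + dg \<and> dw\<close> at fixed time, so \<open>(x, f, g, w)\<close> are again
canonical coordinates, related to the original ones by an invertible polynomial map. In them
\<open>s3\<close> becomes
  \<open>(x, f, g, w) \<mapsto> (x - (g * w - \<alpha>1) / f, f, -f / g, g * (g * w + \<alpha>3) / f)\<close>,
and the normalization turns the system into one with polynomial right-hand sides in which only
\<open>\<alpha>1\<close> and \<open>\<alpha>3\<close> occur (\<open>adapted_solution_if_solution\<close>, \<open>solution_if_adapted_solution\<close>). For
this short map each claim is a direct calculation: that it is symplectic
(\<open>s3_adapted_symplectic\<close>), that it is inverted by replacing \<open>\<alpha>1\<close> with \<open>-\<alpha>1 - \<alpha>3\<close>
(\<open>s3_adapted_s3_adapted\<close>), and that it carries solutions to solutions for that same replacement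
(\<open>adapted_solution_s3_adapted\<close>). Conjugating back gives the claims for \<open>s3\<close>.\<close>

section \<open>Components of vectors of length four and five\<close>

lemma vector_4 [simp]:
  "(vector [a, b, c, d] :: 'a::zero ^ 4) $ 1 = a"
  "(vector [a, b, c, d] :: 'a::zero ^ 4) $ 2 = b"
  "(vector [a, b, c, d] :: 'a::zero ^ 4) $ 3 = c"
  "(vector [a, b, c, d] :: 'a::zero ^ 4) $ 4 = d"
  unfolding vector_def by simp_all

lemma vector_5 [simp]:
  "(vector [a, b, c, d, e] :: 'a::zero ^ 5) $ 1 = a"
  "(vector [a, b, c, d, e] :: 'a::zero ^ 5) $ 2 = b"
  "(vector [a, b, c, d, e] :: 'a::zero ^ 5) $ 3 = c"
  "(vector [a, b, c, d, e] :: 'a::zero ^ 5) $ 4 = d"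
  "(vector [a, b, c, d, e] :: 'a::zero ^ 5) $ 5 = e"
  unfolding vector_def by simp_all

lemma exhaust_5:
  fixes i :: 5
  shows "i = 1 \<or> i = 2 \<or> i = 3 \<or> i = 4 \<or> i = 5"
proof (induct i)
  case (of_int z)
  then have "z = 0 \<or> z = 1 \<or> z = 2 \<or> z = 3 \<or> z = 4" by fastforce
  then show ?case by auto
qed

lemma forall_5: "(\<forall>i::5. P i) \<longleftrightarrow> P 1 \<and> P 2 \<and> P 3 \<and> P 4 \<and> P 5"
  by (metis exhaust_5)

lemmas has_derivative_nth = bounded_linear.has_derivative[OF bounded_linear_vec_nth]

lemma has_derivative_vector_4:
  fixes a b c d :: "'a::real_normed_vector \<Rightarrow> complex"
  assumes "(a has_derivative a') F" "(b has_derivative b') F"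
    "(c has_derivative c') F" "(d has_derivative d') F"
  shows "((\<lambda>p. vector [a p, b p, c p, d p] :: phase) has_derivative
    (\<lambda>v. vector [a' v, b' v, c' v, d' v])) F"
proof -
  have axis_expansion:
    "(vector [x, y, z, w] :: phase) = axis 1 x + axis 2 y + axis 3 z + axis 4 w" for x y z w
    by (simp add: vec_eq_iff forall_4 axis_def)
  have "bounded_linear (axis i :: complex \<Rightarrow> phase)" for i
    by (rule linear_conv_bounded_linear[THEN iffD1])
      (auto intro!: linearI simp: axis_def vec_eq_iff)
  note axis = bounded_linear.has_derivative[OF this]
  show ?thesis
    unfolding axis_expansion by (intro has_derivative_add axis assms)
qed


section \<open>Symplectic maps\<close>

text \<open>A real derivative that commutes with complex scalars is complex linear, hence given by a complex
matrix; this frees calculations from explicit Jacobian matrices.\<close>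

lemma symplectic_onI:
  assumes "\<And>p. p \<in> D \<Longrightarrow> (F has_derivative L p) (at p)"
    and "\<And>p c v. p \<in> D \<Longrightarrow> L p (c *s v) = c *s L p v"
    and "\<And>p u v. p \<in> D \<Longrightarrow> symp_form (L p u) (L p v) = symp_form u v"
  shows "symplectic_on D F"
  unfolding symplectic_on_def
proof (rule ballI)
  fix p assume p: "p \<in> D"
  have "linear (L p)"
    using assms(1)[OF p] by (rule has_derivative_linear)
  then have "Vector_Spaces.linear (*s) (*s) (L p)"
    by (simp add: Vector_Spaces.linear_iff vec.vector_space_axioms linear_add assms(2)[OF p])
  then have "matrix (L p) *v v = L p v" for v
    by (rule matrix_works)
  then show "\<exists>J. (F has_derivative (\<lambda>v. J *v v)) (at p) \<and>
      (\<forall>u v. symp_form (J *v u) (J *v v) = symp_form u v)"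
    using assms(1,3)[OF p] by (intro exI[of _ "matrix (L p)"]) simp
qed

lemma symplectic_on_comp:
  assumes "symplectic_on D F" "symplectic_on E G" "\<And>p. p \<in> D \<Longrightarrow> F p \<in> E"
  shows "symplectic_on D (\<lambda>p. G (F p))"
  unfolding symplectic_on_def
proof (rule ballI)
  fix p assume p: "p \<in> D"
  obtain A :: "complex^4^4" where A: "(F has_derivative (\<lambda>v. A *v v)) (at p)"
    "\<And>u v. symp_form (A *v u) (A *v v) = symp_form u v"
    using assms(1) p unfolding symplectic_on_def by blast
  obtain B :: "complex^4^4" where B: "(G has_derivative (\<lambda>v. B *v v)) (at (F p))"
    "\<And>u v. symp_form (B *v u) (B *v v) = symp_form u v"
    using assms(2) assms(3)[OF p] unfolding symplectic_on_def by blast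
  have "((\<lambda>p. G (F p)) has_derivative (\<lambda>v. (B ** A) *v v)) (at p)"
    using diff_chain_at[OF A(1) B(1)] by (simp add: o_def matrix_vector_mul_assoc)
  then show "\<exists>J. ((\<lambda>p. G (F p)) has_derivative (\<lambda>v. J *v v)) (at p) \<and>
      (\<forall>u v. symp_form (J *v u) (J *v v) = symp_form u v)"
    using A(2) B(2) by (intro exI[of _ "B ** A"]) (simp flip: matrix_vector_mul_assoc)
qed


section \<open>Polynomial and rational functions\<close>

lemma cpolynomial_minus:
  assumes "cpolynomial f"
  shows "cpolynomial (\<lambda>p. - f p)"
proof -
  have "cpolynomial (\<lambda>p. - 1 * f p)"
    by (rule cpolynomial.mult[OF cpolynomial.const assms])
  then show ?thesis by simp
qed

lemma cpolynomial_diff: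
  assumes "cpolynomial f" "cpolynomial g"
  shows "cpolynomial (\<lambda>p. f p - g p)"
proof -
  have "cpolynomial (\<lambda>p. f p + - g p)"
    by (rule cpolynomial.add[OF assms(1) cpolynomial_minus[OF assms(2)]])
  then show ?thesis by simp
qed

lemma cpolynomial_power:
  assumes "cpolynomial f"
  shows "cpolynomial (\<lambda>p. f p ^ n)"
proof (induction n)
  case 0
  show ?case unfolding power_0 by (rule cpolynomial.const)
next
  case (Suc n)
  show ?case unfolding power_Suc by (rule cpolynomial.mult[OF assms Suc])
qed

lemmas cpolynomial_intros = cpolynomial.intros cpolynomial_minus cpolynomial_diff cpolynomial_power

lemma cpolynomial_compose:
  assumes "cpolynomial P" "\<And>i. cpolynomial (\<lambda>q. h q $ i)"
  shows "cpolynomial (\<lambda>q. P (h q))"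
  using assms(1)
proof induction
  case (const c)
  show ?case by (rule cpolynomial.const)
next
  case (coord i)
  show ?case by (rule assms(2))
next
  case (add f g)
  show ?case by (rule cpolynomial.add[OF add.IH])
next
  case (mult f g)
  show ?case by (rule cpolynomial.mult[OF mult.IH])
qed

text \<open>\<open>phase_of\<close> forgets the time; \<open>ext_of t\<close> is the section of it over the time \<open>t\<close>.\<close>

definition ext_of :: "complex \<Rightarrow> phase \<Rightarrow> ext_phase" where
  "ext_of t p = vector [p $ 1, p $ 2, p $ 3, p $ 4, t]"

lemma phase_of_nth [simp]:
  "phase_of q $ 1 = q $ 1" "phase_of q $ 2 = q $ 2" "phase_of q $ 3 = q $ 3" "phase_of q $ 4 = q $ 4"
  by (simp_all add: phase_of_def)

lemma ext_of_nth_5 [simp]: "ext_of t p $ 5 = t"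
  by (simp add: ext_of_def)

lemma phase_of_ext_of [simp]: "phase_of (ext_of t p) = p"
  by (simp add: vec_eq_iff forall_4 ext_of_def)

lemma ext_of_phase_of [simp]: "ext_of (q $ 5) (phase_of q) = q"
  by (simp add: vec_eq_iff forall_5 ext_of_def)

lemma ext_map_eq: "ext_map F q = ext_of (q $ 5) (F (q $ 5) (phase_of q))"
  by (simp add: ext_map_def ext_of_def Let_def)

lemma ext_of_in_ext_dom [simp]: "ext_of t p \<in> ext_dom D \<longleftrightarrow> p \<in> D t"
  by (simp add: ext_dom_def)

text \<open>The phase components determine everything: the time, which the map leaves alone, is written over
the same denominator as \<open>(t * Q) / Q\<close>.\<close>

lemma rational_on_ext_mapI:
  fixes P :: "ext_phase \<Rightarrow> phase"
  assumes "\<And>i. cpolynomial (\<lambda>q. P q $ i)" "cpolynomial Q"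
    and "ext_dom D = {q. Q q \<noteq> 0}" "p0 \<in> D t0"
    and "\<And>q i. Q q \<noteq> 0 \<Longrightarrow> F (q $ 5) (phase_of q) $ i = P q $ i / Q q"
  shows "rational_on (ext_dom D) (ext_map F)"
proof -
  define R where "R i q = ext_of (q $ 5 * Q q) (P q) $ i" for i :: 5 and q
  have "\<forall>i. cpolynomial (R i)"
    unfolding forall_5 R_def ext_of_def vector_5
    by (intro conjI cpolynomial.mult cpolynomial.coord assms(1,2))
  moreover have "ext_dom D \<noteq> {}"
    using assms(4) by (metis empty_iff ext_of_in_ext_dom)
  moreover have "\<forall>q\<in>ext_dom D. \<forall>i. ext_map F q $ i = R i q / Q q"
    by (simp add: assms(3,5) forall_5 ext_map_eq R_def ext_of_def)
  ultimately show ?thesis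
    unfolding rational_on_def using assms(2,3) by blast
qed

text \<open>Fixing the time substitutes a constant for one variable in the numerators and the denominator.
Nonemptiness of \<open>D t\<close> says that the denominator does not become the zero polynomial.\<close>

lemma rational_on_slice:
  assumes "rational_on (ext_dom D) (ext_map F)" "D t \<noteq> {}"
  shows "rational_on (D t) (F t)"
proof -
  obtain P Q where PQ: "\<And>i. cpolynomial (P i)" "cpolynomial Q" "ext_dom D = {q. Q q \<noteq> 0}"
    "\<And>q i. q \<in> ext_dom D \<Longrightarrow> ext_map F q $ i = P i q / Q q"
    using assms(1) unfolding rational_on_def by blast
  have ext_of: "\<forall>i. cpolynomial (\<lambda>p. ext_of t p $ i)"
    unfolding forall_5 ext_of_def vector_5
    by (intro conjI cpolynomial.coord cpolynomial.const)
  \<comment> \<open>the embedding of the phase coordinates among the extended ones\<close>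
  define idx :: "4 \<Rightarrow> 5" where "idx i = (if i = 1 then 1 else if i = 2 then 2 else if i = 3 then 3 else 4)" for i
  have idx: "\<forall>i. ext_of s p $ idx i = p $ i" for s p
    unfolding forall_4 by (simp add: idx_def ext_of_def)
  have "F t p $ i = P (idx i) (ext_of t p) / Q (ext_of t p)" if "p \<in> D t" for p i
    using PQ(4)[of "ext_of t p" "idx i"] that by (simp add: ext_map_eq idx)
  moreover have "D t = {p. Q (ext_of t p) \<noteq> 0}"
    using PQ(3) ext_of_in_ext_dom[of t _ D] by auto
  moreover have "cpolynomial (\<lambda>p. Q (ext_of t p))" "cpolynomial (\<lambda>p. P (idx i) (ext_of t p))" for i
    by (rule cpolynomial_compose[OF _ spec[OF ext_of]], rule PQ)+
  ultimately show ?thesis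
    unfolding rational_on_def using assms(2)
    by (intro exI[of _ "\<lambda>i p. P (idx i) (ext_of t p)"] exI[of _ "\<lambda>p. Q (ext_of t p)"]) blast
qed

lemma birational_onI:
  assumes "rational_on D F" "rational_on D G"
    and "\<And>p. p \<in> D \<Longrightarrow> F p \<in> D" "\<And>p. p \<in> D \<Longrightarrow> G p \<in> D"
    and "\<And>p. p \<in> D \<Longrightarrow> G (F p) = p" "\<And>p. p \<in> D \<Longrightarrow> F (G p) = p"
  shows "birational_on D F"
proof -
  obtain p where "p \<in> D"
    using assms(1) unfolding rational_on_def by blast
  then show ?thesis
    unfolding birational_on_def using assms by blast
qed

text \<open>For a map that is inverted on its own domain, rationality in the extended variables suffices:
bijectivity at each time gives bijectivity on the extended domain, and rationality at each time
follows by \<open>rational_on_slice\<close>.\<close>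

lemma birational_transformationI:
  assumes "rational_on (ext_dom D) (ext_map F)" "rational_on (ext_dom D) (ext_map G)"
    and "\<And>t. D t \<noteq> {}"
    and "\<And>t p. p \<in> D t \<Longrightarrow> F t p \<in> D t" "\<And>t p. p \<in> D t \<Longrightarrow> G t p \<in> D t"
    and "\<And>t p. p \<in> D t \<Longrightarrow> G t (F t p) = p" "\<And>t p. p \<in> D t \<Longrightarrow> F t (G t p) = p"
  shows "birational_transformation D F"
  unfolding birational_transformation_def
proof (intro conjI allI)
  show "birational_on (D t) (F t)" for t
    by (rule birational_onI[OF rational_on_slice rational_on_slice, OF assms(1,3) assms(2,3)])
      (simp_all add: assms(4-7))
  have "phase_of q \<in> D (q $ 5) \<longleftrightarrow> q \<in> ext_dom D" for q
    by (simp add: ext_dom_def)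
  then show "birational_on (ext_dom D) (ext_map F)"
    by (intro birational_onI[where G = "ext_map G"] assms(1,2))
      (simp_all add: ext_map_eq assms(4-7))
qed


section \<open>The shears\<close>

lemma solutionD:
  assumes "solution (\<alpha>1, \<alpha>2, \<alpha>3) U u" "t \<in> U"
  shows "((\<lambda>s. u s $ 1) has_field_derivative
      - 2 * (u t $ 1)^2 + 4 * u t $ 2 - 3 * u t $ 4 - 2 * t) (at t)"
    and "((\<lambda>s. u s $ 2) has_field_derivative 4 * u t $ 1 * u t $ 2 + 2 * \<alpha>2) (at t)"
    and "((\<lambda>s. u s $ 3) has_field_derivative
      (u t $ 3)^2 + 2 * u t $ 4 - 3 * u t $ 2 + t) (at t)"
    and "((\<lambda>s. u s $ 4) has_field_derivative - 2 * u t $ 3 * u t $ 4 - \<alpha>3) (at t)"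
  using assms by (simp_all add: solution_iff Let_def)

lemma s1_eq: "s1 (\<alpha>1, \<alpha>2, \<alpha>3) t p = vector [p $ 1 + \<alpha>2 / p $ 2, p $ 2, p $ 3, p $ 4]"
  by (simp add: s1_def Let_def)

lemma s2_eq: "s2 (\<alpha>1, \<alpha>2, \<alpha>3) t p = vector [p $ 1, p $ 2, p $ 3 + \<alpha>3 / p $ 4, p $ 4]"
  by (simp add: s2_def Let_def)

text \<open>The only equations that contain \<open>x\<close> are those for \<open>x\<close> and \<open>y\<close>. In the second the sign change
of \<open>\<alpha>2\<close> is compensated by \<open>4 * (\<alpha>2 / y) * y = 4 * \<alpha>2\<close>; in the first
\<open>-\<alpha>2 * (4 * x * y + 2 * \<alpha>2) / y^2\<close> completes \<open>-2 * x^2\<close> to \<open>-2 * (x + \<alpha>2 / y)^2\<close>.\<close>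

lemma s1_invariant:
  assumes "2 * \<alpha>1 + 2 * \<alpha>2 + \<alpha>3 = 1"
  shows "invariant_under (\<alpha>1, \<alpha>2, \<alpha>3) s1_dom s1 s1_par"
  unfolding invariant_under_def
proof (intro conjI allI impI)
  show "normalized (s1_par (\<alpha>1, \<alpha>2, \<alpha>3))"
    using assms by (simp add: normalized_def s1_par_def algebra_simps)
next
  fix U u assume *: "solution (\<alpha>1, \<alpha>2, \<alpha>3) U u \<and> (\<forall>t\<in>U. u t \<in> s1_dom t)"
  show "solution (s1_par (\<alpha>1, \<alpha>2, \<alpha>3)) U (\<lambda>t. s1 (\<alpha>1, \<alpha>2, \<alpha>3) t (u t))"
    unfolding s1_par_def split_conv solution_iff s1_eq Let_def vector_4
  proof (intro conjI ballI)
    show "open U" using * by (simp add: solution_def)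
    fix t assume t: "t \<in> U"
    have nz: "u t $ 2 \<noteq> 0" using * t by (simp add: s1_dom_def)
    note d = solutionD[OF conjunct1[OF *] t]
    show "((\<lambda>s. u s $ 1 + \<alpha>2 / u s $ 2) has_field_derivative
        - 2 * (u t $ 1 + \<alpha>2 / u t $ 2)^2 + 4 * u t $ 2 - 3 * u t $ 4 - 2 * t) (at t)"
      by (rule d nz derivative_eq_intros refl)+ (use nz in \<open>simp add: field_simps power2_eq_square\<close>)
    show "((\<lambda>s. u s $ 2) has_field_derivative 4 * (u t $ 1 + \<alpha>2 / u t $ 2) * u t $ 2 + 2 * - \<alpha>2) (at t)"
      by (rule DERIV_cong[OF d(2)]) (use nz in \<open>simp add: field_simps\<close>)
    show "((\<lambda>s. u s $ 3) has_field_derivative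
        (u t $ 3)^2 + 2 * u t $ 4 - 3 * u t $ 2 + t) (at t)"
      by (rule d)
    show "((\<lambda>s. u s $ 4) has_field_derivative - 2 * u t $ 3 * u t $ 4 - \<alpha>3) (at t)"
      by (rule d)
  qed
qed

text \<open>As for \<open>s1\<close>, with the pair \<open>z\<close>, \<open>w\<close>: here \<open>\<alpha>3 * (2 * z * w + \<alpha>3) / w^2\<close> completes \<open>z^2\<close> to
\<open>(z + \<alpha>3 / w)^2\<close>.\<close>

lemma s2_invariant:
  assumes "2 * \<alpha>1 + 2 * \<alpha>2 + \<alpha>3 = 1"
  shows "invariant_under (\<alpha>1, \<alpha>2, \<alpha>3) s2_dom s2 s2_par"
  unfolding invariant_under_def
proof (intro conjI allI impI)
  show "normalized (s2_par (\<alpha>1, \<alpha>2, \<alpha>3))"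
    using assms by (simp add: normalized_def s2_par_def algebra_simps)
next
  fix U u assume *: "solution (\<alpha>1, \<alpha>2, \<alpha>3) U u \<and> (\<forall>t\<in>U. u t \<in> s2_dom t)"
  show "solution (s2_par (\<alpha>1, \<alpha>2, \<alpha>3)) U (\<lambda>t. s2 (\<alpha>1, \<alpha>2, \<alpha>3) t (u t))"
    unfolding s2_par_def split_conv solution_iff s2_eq Let_def vector_4
  proof (intro conjI ballI)
    show "open U" using * by (simp add: solution_def)
    fix t assume t: "t \<in> U"
    have nz: "u t $ 4 \<noteq> 0" using * t by (simp add: s2_dom_def)
    note d = solutionD[OF conjunct1[OF *] t]
    show "((\<lambda>s. u s $ 1) has_field_derivative
        - 2 * (u t $ 1)^2 + 4 * u t $ 2 - 3 * u t $ 4 - 2 * t) (at t)"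
      by (rule d)
    show "((\<lambda>s. u s $ 2) has_field_derivative 4 * u t $ 1 * u t $ 2 + 2 * \<alpha>2) (at t)"
      by (rule d)
    show "((\<lambda>s. u s $ 3 + \<alpha>3 / u s $ 4) has_field_derivative
        (u t $ 3 + \<alpha>3 / u t $ 4)^2 + 2 * u t $ 4 - 3 * u t $ 2 + t) (at t)"
      by (rule d nz derivative_eq_intros refl)+ (use nz in \<open>simp add: field_simps power2_eq_square\<close>)
    show "((\<lambda>s. u s $ 4) has_field_derivative - 2 * (u t $ 3 + \<alpha>3 / u t $ 4) * u t $ 4 - - \<alpha>3) (at t)"
      by (rule DERIV_cong[OF d(4)]) (use nz in \<open>simp add: field_simps\<close>)
  qed
qed

lemma s1_rational: "rational_on (ext_dom s1_dom) (ext_map (s1 \<alpha>))"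
proof -
  obtain \<alpha>1 \<alpha>2 \<alpha>3 where \<alpha>: "\<alpha> = (\<alpha>1, \<alpha>2, \<alpha>3)" by (cases \<alpha>)
  let ?P = "\<lambda>q::ext_phase. vector [q $ 1 * q $ 2 + \<alpha>2, q $ 2 * q $ 2, q $ 3 * q $ 2, q $ 4 * q $ 2] :: phase"
  have "\<forall>i. cpolynomial (\<lambda>q. ?P q $ i)"
    unfolding forall_4 vector_4 by (intro conjI cpolynomial_intros)
  moreover have "\<forall>i. s1 \<alpha> (q $ 5) (phase_of q) $ i = ?P q $ i / q $ 2" if "q $ 2 \<noteq> 0" for q
    unfolding forall_4 \<alpha> s1_eq vector_4 phase_of_nth using that by (simp add: field_simps)
  ultimately show ?thesis
    by (intro rational_on_ext_mapI[where P = ?P and Q = "\<lambda>q. q $ 2" and ?p0.0 = 1])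
      (auto simp: ext_dom_def s1_dom_def cpolynomial.coord)
qed

lemma s2_rational: "rational_on (ext_dom s2_dom) (ext_map (s2 \<alpha>))"
proof -
  obtain \<alpha>1 \<alpha>2 \<alpha>3 where \<alpha>: "\<alpha> = (\<alpha>1, \<alpha>2, \<alpha>3)" by (cases \<alpha>)
  let ?P = "\<lambda>q::ext_phase. vector [q $ 1 * q $ 4, q $ 2 * q $ 4, q $ 3 * q $ 4 + \<alpha>3, q $ 4 * q $ 4] :: phase"
  have "\<forall>i. cpolynomial (\<lambda>q. ?P q $ i)"
    unfolding forall_4 vector_4 by (intro conjI cpolynomial_intros)
  moreover have "\<forall>i. s2 \<alpha> (q $ 5) (phase_of q) $ i = ?P q $ i / q $ 4" if "q $ 4 \<noteq> 0" for q
    unfolding forall_4 \<alpha> s2_eq vector_4 phase_of_nth using that by (simp add: field_simps)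
  ultimately show ?thesis
    by (intro rational_on_ext_mapI[where P = ?P and Q = "\<lambda>q. q $ 4" and ?p0.0 = 1])
      (auto simp: ext_dom_def s2_dom_def cpolynomial.coord)
qed

lemma s1_birational: "birational_transformation s1_dom (s1 (\<alpha>1, \<alpha>2, \<alpha>3))"
proof (rule birational_transformationI[where G = "s1 (s1_par (\<alpha>1, \<alpha>2, \<alpha>3))"])
  show "s1_dom t \<noteq> {}" for t
    by (auto simp: s1_dom_def intro: exI[of _ 1])
  fix t p assume "p \<in> s1_dom t"
  then show "s1 (s1_par (\<alpha>1, \<alpha>2, \<alpha>3)) t (s1 (\<alpha>1, \<alpha>2, \<alpha>3) t p) = p"
    "s1 (\<alpha>1, \<alpha>2, \<alpha>3) t (s1 (s1_par (\<alpha>1, \<alpha>2, \<alpha>3)) t p) = p"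
    "s1 (\<alpha>1, \<alpha>2, \<alpha>3) t p \<in> s1_dom t"
    "s1 (s1_par (\<alpha>1, \<alpha>2, \<alpha>3)) t p \<in> s1_dom t"
    by (simp_all add: s1_eq s1_par_def s1_dom_def vec_eq_iff forall_4)
qed (rule s1_rational)+

lemma s2_birational: "birational_transformation s2_dom (s2 (\<alpha>1, \<alpha>2, \<alpha>3))"
proof (rule birational_transformationI[where G = "s2 (s2_par (\<alpha>1, \<alpha>2, \<alpha>3))"])
  show "s2_dom t \<noteq> {}" for t
    by (auto simp: s2_dom_def intro: exI[of _ 1])
  fix t p assume "p \<in> s2_dom t"
  then show "s2 (s2_par (\<alpha>1, \<alpha>2, \<alpha>3)) t (s2 (\<alpha>1, \<alpha>2, \<alpha>3) t p) = p"
    "s2 (\<alpha>1, \<alpha>2, \<alpha>3) t (s2 (s2_par (\<alpha>1, \<alpha>2, \<alpha>3)) t p) = p"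
    "s2 (\<alpha>1, \<alpha>2, \<alpha>3) t p \<in> s2_dom t"
    "s2 (s2_par (\<alpha>1, \<alpha>2, \<alpha>3)) t p \<in> s2_dom t"
    by (simp_all add: s2_eq s2_par_def s2_dom_def vec_eq_iff forall_4)
qed (rule s2_rational)+

lemma s1_symplectic: "symplectic_transformation s1_dom (s1 (\<alpha>1, \<alpha>2, \<alpha>3))"
  unfolding symplectic_transformation_def
proof
  fix t
  show "symplectic_on (s1_dom t) (s1 (\<alpha>1, \<alpha>2, \<alpha>3) t)"
  proof (rule symplectic_onI)
    fix p assume "p \<in> s1_dom t"
    then have "p $ 2 \<noteq> 0" by (simp add: s1_dom_def)
    then show "(s1 (\<alpha>1, \<alpha>2, \<alpha>3) t has_derivative
        (\<lambda>v. vector [v $ 1 - \<alpha>2 * v $ 2 / (p $ 2)^2, v $ 2, v $ 3, v $ 4])) (at p)"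
      unfolding s1_eq
      by (intro has_derivative_vector_4)
        (auto intro!: derivative_eq_intros has_derivative_nth simp: power2_eq_square)
  qed (simp_all add: vec_eq_iff forall_4 symp_form_def algebra_simps)
qed

lemma s2_symplectic: "symplectic_transformation s2_dom (s2 (\<alpha>1, \<alpha>2, \<alpha>3))"
  unfolding symplectic_transformation_def
proof
  fix t
  show "symplectic_on (s2_dom t) (s2 (\<alpha>1, \<alpha>2, \<alpha>3) t)"
  proof (rule symplectic_onI)
    fix p assume "p \<in> s2_dom t"
    then have "p $ 4 \<noteq> 0" by (simp add: s2_dom_def)
    then show "(s2 (\<alpha>1, \<alpha>2, \<alpha>3) t has_derivative
        (\<lambda>v. vector [v $ 1, v $ 2, v $ 3 - \<alpha>3 * v $ 4 / (p $ 4)^2, v $ 4])) (at p)"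
      unfolding s2_eq
      by (intro has_derivative_vector_4)
        (auto intro!: derivative_eq_intros has_derivative_nth simp: power2_eq_square)
  qed (simp_all add: vec_eq_iff forall_4 symp_form_def algebra_simps)
qed


section \<open>Adapted canonical coordinates\<close>

text \<open>The coordinates \<open>(x, f, g, w)\<close>. Their order makes \<open>symp_form\<close> on them the form
\<open>dx \<and> df + dg \<and> dw\<close>.\<close>

definition adapted :: "complex \<Rightarrow> phase \<Rightarrow> phase" where
  "adapted t p = vector [p $ 1, f3 t p, g3 p, p $ 4]"

definition adapted_inv :: "complex \<Rightarrow> phase \<Rightarrow> phase" where
  "adapted_inv t q = vector [q $ 1, q $ 2 + (q $ 1)^2 + q $ 4 + t, q $ 3 - q $ 1, q $ 4]"

lemma adapted_inv_adapted [simp]: "adapted_inv t (adapted t p) = p"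
  by (simp add: adapted_def adapted_inv_def f3_def g3_def vec_eq_iff forall_4)

lemma adapted_adapted_inv [simp]: "adapted t (adapted_inv t q) = q"
  by (simp add: adapted_def adapted_inv_def f3_def g3_def vec_eq_iff forall_4)

text \<open>At fixed time \<open>dy = df + 2 * x dx + dw\<close>, so \<open>dx \<and> dy = dx \<and> df + dx \<and> dw\<close>, and the last term
joins \<open>dz \<and> dw\<close> to form \<open>dg \<and> dw\<close>.\<close>

lemma adapted_symplectic: "symplectic_on UNIV (adapted t)"
proof (rule symplectic_onI)
  show "(adapted t has_derivative
      (\<lambda>v. vector [v $ 1, v $ 2 - 2 * p $ 1 * v $ 1 - v $ 4, v $ 1 + v $ 3, v $ 4])) (at p)" for p
    unfolding adapted_def f3_def g3_def
    by (intro has_derivative_vector_4)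
      (auto intro!: derivative_eq_intros has_derivative_nth)
qed (simp_all add: vec_eq_iff forall_4 symp_form_def algebra_simps)

lemma adapted_inv_symplectic: "symplectic_on UNIV (adapted_inv t)"
proof (rule symplectic_onI)
  show "(adapted_inv t has_derivative
      (\<lambda>v. vector [v $ 1, v $ 2 + 2 * p $ 1 * v $ 1 + v $ 4, v $ 3 - v $ 1, v $ 4])) (at p)" for p
    unfolding adapted_inv_def
    by (intro has_derivative_vector_4)
      (auto intro!: derivative_eq_intros has_derivative_nth)
qed (simp_all add: vec_eq_iff forall_4 symp_form_def algebra_simps)

text \<open>Hamilton's equations in the pairs \<open>(x, f)\<close> and \<open>(g, w)\<close> for
\<open>2 * f^2 + 2 * x^2 * f + w * f + 2 * t * f - 2 * g * w * x + 2 * \<alpha>1 * x + g^2 * w + \<alpha>3 * g\<close>.\<close>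

definition adapted_solution ::
  "complex \<Rightarrow> complex \<Rightarrow> complex set \<Rightarrow> (complex \<Rightarrow> phase) \<Rightarrow> bool" where
  "adapted_solution \<alpha>1 \<alpha>3 U v \<longleftrightarrow> open U \<and> (\<forall>t\<in>U.
     (let x = v t $ 1; f = v t $ 2; g = v t $ 3; w = v t $ 4 in
        ((\<lambda>s. v s $ 1) has_field_derivative 4 * f + 2 * x^2 + w + 2 * t) (at t) \<and>
        ((\<lambda>s. v s $ 2) has_field_derivative - 4 * x * f + 2 * g * w - 2 * \<alpha>1) (at t) \<and>
        ((\<lambda>s. v s $ 3) has_field_derivative f + g^2 - 2 * g * x) (at t) \<and>
        ((\<lambda>s. v s $ 4) has_field_derivative - 2 * (g - x) * w - \<alpha>3) (at t)))"

lemma adapted_solutionD: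
  assumes "adapted_solution \<alpha>1 \<alpha>3 U v" "t \<in> U"
  shows "((\<lambda>s. v s $ 1) has_field_derivative 4 * v t $ 2 + 2 * (v t $ 1)^2 + v t $ 4 + 2 * t) (at t)"
    and "((\<lambda>s. v s $ 2) has_field_derivative
      - 4 * v t $ 1 * v t $ 2 + 2 * v t $ 3 * v t $ 4 - 2 * \<alpha>1) (at t)"
    and "((\<lambda>s. v s $ 3) has_field_derivative v t $ 2 + (v t $ 3)^2 - 2 * v t $ 3 * v t $ 1) (at t)"
    and "((\<lambda>s. v s $ 4) has_field_derivative - 2 * (v t $ 3 - v t $ 1) * v t $ 4 - \<alpha>3) (at t)"
  using assms by (simp_all add: adapted_solution_def Let_def)

text \<open>Differentiating \<open>f\<close> produces the constant term \<open>2 * \<alpha>2 + \<alpha>3 - 1\<close>, where \<open>-1\<close> comes from the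
explicit time dependence of \<open>f\<close>. The normalization identifies it with \<open>-2 * \<alpha>1\<close>; this is
where \<open>\<alpha>1\<close>, which the original equations do not contain, enters.\<close>

lemma adapted_solution_if_solution:
  assumes norm: "2 * \<alpha>1 + 2 * \<alpha>2 + \<alpha>3 = 1" and sol: "solution (\<alpha>1, \<alpha>2, \<alpha>3) U u"
  shows "adapted_solution \<alpha>1 \<alpha>3 U (\<lambda>t. adapted t (u t))"
  unfolding adapted_solution_def adapted_def f3_def g3_def Let_def vector_4
proof (intro conjI ballI)
  have \<alpha>3: "\<alpha>3 = 1 - 2 * \<alpha>1 - 2 * \<alpha>2" using norm by (simp add: algebra_simps)
  show "open U" using sol by (simp add: solution_def)
  fix t assume t: "t \<in> U"
  note d = solutionD[OF sol t]
  let ?x = "u t $ 1" and ?y = "u t $ 2" and ?z = "u t $ 3" and ?w = "u t $ 4"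
  let ?f = "?y - ?x^2 - ?w - t" and ?g = "?x + ?z"
  show "((\<lambda>s. u s $ 1) has_field_derivative 4 * ?f + 2 * ?x^2 + ?w + 2 * t) (at t)"
    by (rule DERIV_cong[OF d(1)]) (simp add: algebra_simps)
  show "((\<lambda>s. u s $ 2 - (u s $ 1)^2 - u s $ 4 - s) has_field_derivative
      - 4 * ?x * ?f + 2 * ?g * ?w - 2 * \<alpha>1) (at t)"
    by (rule d derivative_eq_intros refl)+ (simp add: \<alpha>3 algebra_simps power2_eq_square)
  show "((\<lambda>s. u s $ 1 + u s $ 3) has_field_derivative ?f + ?g^2 - 2 * ?g * ?x) (at t)"
    by (rule d derivative_eq_intros refl)+ (simp add: algebra_simps power2_eq_square)
  show "((\<lambda>s. u s $ 4) has_field_derivative - 2 * (?g - ?x) * ?w - \<alpha>3) (at t)"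
    by (rule DERIV_cong[OF d(4)]) (simp add: algebra_simps)
qed

lemma solution_if_adapted_solution:
  assumes norm: "2 * \<alpha>1 + 2 * \<alpha>2 + \<alpha>3 = 1" and sol: "adapted_solution \<alpha>1 \<alpha>3 U v"
  shows "solution (\<alpha>1, \<alpha>2, \<alpha>3) U (\<lambda>t. adapted_inv t (v t))"
  unfolding solution_iff adapted_inv_def Let_def vector_4
proof (intro conjI ballI)
  have \<alpha>3: "\<alpha>3 = 1 - 2 * \<alpha>1 - 2 * \<alpha>2" using norm by (simp add: algebra_simps)
  show "open U" using sol by (simp add: adapted_solution_def)
  fix t assume t: "t \<in> U"
  note d = adapted_solutionD[OF sol t]
  let ?x = "v t $ 1" and ?f = "v t $ 2" and ?g = "v t $ 3" and ?w = "v t $ 4"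
  let ?y = "?f + ?x^2 + ?w + t" and ?z = "?g - ?x"
  show "((\<lambda>s. v s $ 1) has_field_derivative - 2 * ?x^2 + 4 * ?y - 3 * ?w - 2 * t) (at t)"
    by (rule DERIV_cong[OF d(1)]) (simp add: algebra_simps)
  show "((\<lambda>s. v s $ 2 + (v s $ 1)^2 + v s $ 4 + s) has_field_derivative
      4 * ?x * ?y + 2 * \<alpha>2) (at t)"
    by (rule d derivative_eq_intros refl)+ (simp add: \<alpha>3 algebra_simps power2_eq_square)
  show "((\<lambda>s. v s $ 3 - v s $ 1) has_field_derivative ?z^2 + 2 * ?w - 3 * ?y + t) (at t)"
    by (rule d derivative_eq_intros refl)+ (simp add: algebra_simps power2_eq_square)
  show "((\<lambda>s. v s $ 4) has_field_derivative - 2 * ?z * ?w - \<alpha>3) (at t)"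
    by (rule d)
qed


section \<open>The third transformation in adapted coordinates\<close>

text \<open>The map \<open>s3\<close> in the coordinates \<open>(x, f, g, w)\<close>. The first component is kept over the single
denominator \<open>f\<close>, as in \<open>s3\<close>, so that the two maps correspond even where a denominator vanishes and
division returns zero.\<close>

definition s3_adapted :: "complex \<Rightarrow> complex \<Rightarrow> phase \<Rightarrow> phase" where
  "s3_adapted \<alpha>1 \<alpha>3 q = vector
     [(q $ 1 * q $ 2 - q $ 3 * q $ 4 + \<alpha>1) / q $ 2,
      q $ 2,
      - (q $ 2 / q $ 3),
      q $ 3 * (q $ 3 * q $ 4 + \<alpha>3) / q $ 2]"

definition s3_adapted_dom :: "phase set" where
  "s3_adapted_dom = {q. q $ 2 \<noteq> 0 \<and> q $ 3 \<noteq> 0}"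

lemma s3_dom_iff: "p \<in> s3_dom t \<longleftrightarrow> adapted t p \<in> s3_adapted_dom"
  by (simp add: s3_dom_def s3_adapted_dom_def adapted_def)

lemma s3_adapted_in_s3_adapted_dom: "q \<in> s3_adapted_dom \<Longrightarrow> s3_adapted \<alpha>1 \<alpha>3 q \<in> s3_adapted_dom"
  by (simp add: s3_adapted_dom_def s3_adapted_def)

lemma s3_eq_s3_adapted:
  assumes "2 * \<alpha>1 + 2 * \<alpha>2 + \<alpha>3 = 1"
  shows "s3 (\<alpha>1, \<alpha>2, \<alpha>3) t p = adapted_inv t (s3_adapted \<alpha>1 \<alpha>3 (adapted t p))"
proof -
  have factor: "- 1 - g * w + 2 * \<alpha>1 + 2 * \<alpha>2 = - (g * w + \<alpha>3)" for g w
    using assms by (simp add: algebra_simps)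
  show ?thesis
    unfolding s3_def split_conv Let_def factor
    by (simp add: adapted_inv_def s3_adapted_def adapted_def vec_eq_iff forall_4 f3_def power_divide
        del: minus_add_distrib)
qed

text \<open>Write capital letters for the image. Then \<open>F = f\<close>, \<open>G = -f / g\<close> and \<open>G * W = -(g * w + \<alpha>3)\<close>,
so repeating the map restores \<open>g\<close> and \<open>g * w\<close>. The two shifts of \<open>x\<close> add up to
\<open>-(g * w + G * W - \<alpha>1 - \<alpha>1') / f\<close>, which vanishes for \<open>\<alpha>1' = -\<alpha>1 - \<alpha>3\<close>.\<close>

lemma s3_adapted_s3_adapted:
  assumes "q \<in> s3_adapted_dom"
  shows "s3_adapted (- \<alpha>1 - \<alpha>3) \<alpha>3 (s3_adapted \<alpha>1 \<alpha>3 q) = q"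
  using assms by (simp add: s3_adapted_dom_def s3_adapted_def vec_eq_iff forall_4 field_simps)

text \<open>With capital letters for the image,
\<open>dG \<and> dW = (dG / G) \<and> d(G * W) = (df / f - dg / g) \<and> (-d(g * w)) = dg \<and> dw + d(g * w) \<and> df / f\<close>,
while \<open>dX \<and> dF = dx \<and> df - d(g * w) \<and> df / f\<close>; the sum is \<open>dx \<and> df + dg \<and> dw\<close>.\<close>

lemma s3_adapted_symplectic: "symplectic_on s3_adapted_dom (s3_adapted \<alpha>1 \<alpha>3)"
proof (rule symplectic_onI)
  fix q assume "q \<in> s3_adapted_dom"
  then have nz: "q $ 2 \<noteq> 0" "q $ 3 \<noteq> 0" by (simp_all add: s3_adapted_dom_def)
  define L :: "phase \<Rightarrow> phase" where "L v = vector
      [v $ 1 - (q $ 4 * v $ 3 + q $ 3 * v $ 4) / q $ 2 + (q $ 3 * q $ 4 - \<alpha>1) * v $ 2 / (q $ 2)^2,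
       v $ 2,
       - (v $ 2 / q $ 3) + q $ 2 * v $ 3 / (q $ 3)^2,
       ((2 * q $ 3 * q $ 4 + \<alpha>3) * v $ 3 + (q $ 3)^2 * v $ 4) / q $ 2
         - q $ 3 * (q $ 3 * q $ 4 + \<alpha>3) * v $ 2 / (q $ 2)^2]" for v
  show "(s3_adapted \<alpha>1 \<alpha>3 has_derivative L) (at q)"
    unfolding s3_adapted_def L_def
    by (intro has_derivative_vector_4)
      (use nz in \<open>auto intro!: derivative_eq_intros has_derivative_nth
        simp: field_simps power2_eq_square\<close>)
  show "L (c *s v) = c *s L v" for c v
    using nz by (simp add: L_def vec_eq_iff forall_4 field_simps)
  show "symp_form (L u) (L v) = symp_form u v" for u v
    using nz by (simp add: L_def symp_form_def field_simps power2_eq_square)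
qed

lemma adapted_solution_s3_adapted:
  assumes "adapted_solution \<alpha>1 \<alpha>3 U v" "\<And>t. t \<in> U \<Longrightarrow> v t \<in> s3_adapted_dom"
  shows "adapted_solution (- \<alpha>1 - \<alpha>3) \<alpha>3 U (\<lambda>t. s3_adapted \<alpha>1 \<alpha>3 (v t))"
  unfolding adapted_solution_def s3_adapted_def Let_def vector_4
proof (intro conjI ballI)
  show "open U" using assms(1) by (simp add: adapted_solution_def)
  fix t assume t: "t \<in> U"
  note d = adapted_solutionD[OF assms(1) t]
  have nz: "v t $ 2 \<noteq> 0" "v t $ 3 \<noteq> 0"
    using assms(2)[OF t] by (simp_all add: s3_adapted_dom_def)
  let ?x = "v t $ 1" and ?f = "v t $ 2" and ?g = "v t $ 3" and ?w = "v t $ 4"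
  let ?X = "(?x * ?f - ?g * ?w + \<alpha>1) / ?f" and ?G = "- (?f / ?g)"
    and ?W = "?g * (?g * ?w + \<alpha>3) / ?f"
  show "((\<lambda>s. (v s $ 1 * v s $ 2 - v s $ 3 * v s $ 4 + \<alpha>1) / v s $ 2) has_field_derivative
      4 * ?f + 2 * ?X^2 + ?W + 2 * t) (at t)"
    by (rule d nz derivative_eq_intros refl)+ (use nz in \<open>simp add: field_simps power2_eq_square\<close>)
  show "((\<lambda>s. v s $ 2) has_field_derivative
      - 4 * ?X * ?f + 2 * ?G * ?W - 2 * (- \<alpha>1 - \<alpha>3)) (at t)"
    by (rule DERIV_cong[OF d(2)]) (use nz in \<open>simp add: field_simps\<close>)
  show "((\<lambda>s. - (v s $ 2 / v s $ 3)) has_field_derivative ?f + ?G^2 - 2 * ?G * ?X) (at t)"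
    by (rule d nz derivative_eq_intros refl)+ (use nz in \<open>simp add: field_simps power2_eq_square\<close>)
  show "((\<lambda>s. v s $ 3 * (v s $ 3 * v s $ 4 + \<alpha>3) / v s $ 2) has_field_derivative
      - 2 * (?G - ?X) * ?W - \<alpha>3) (at t)"
    by (rule d nz derivative_eq_intros refl)+ (use nz in \<open>simp add: field_simps power2_eq_square\<close>)
qed

lemma normalized_s3_par:
  assumes "2 * \<alpha>1 + 2 * \<alpha>2 + \<alpha>3 = (1::complex)"
  shows "2 * (- \<alpha>1 - \<alpha>3) + 2 * (2 * \<alpha>1 + \<alpha>2 + \<alpha>3) + \<alpha>3 = 1"
  using assms by (simp add: algebra_simps)

lemma s3_invariant:
  assumes "2 * \<alpha>1 + 2 * \<alpha>2 + \<alpha>3 = 1"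
  shows "invariant_under (\<alpha>1, \<alpha>2, \<alpha>3) s3_dom s3 s3_par"
  unfolding invariant_under_def
proof (intro conjI allI impI)
  show "normalized (s3_par (\<alpha>1, \<alpha>2, \<alpha>3))"
    using normalized_s3_par[OF assms] by (simp add: normalized_def s3_par_def)
next
  fix U u assume *: "solution (\<alpha>1, \<alpha>2, \<alpha>3) U u \<and> (\<forall>t\<in>U. u t \<in> s3_dom t)"
  then have "adapted_solution \<alpha>1 \<alpha>3 U (\<lambda>t. adapted t (u t))"
    using adapted_solution_if_solution[OF assms] by blast
  then have "adapted_solution (- \<alpha>1 - \<alpha>3) \<alpha>3 U (\<lambda>t. s3_adapted \<alpha>1 \<alpha>3 (adapted t (u t)))"
    by (rule adapted_solution_s3_adapted) (use * in \<open>simp add: s3_dom_iff\<close>)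
  from solution_if_adapted_solution[OF normalized_s3_par[OF assms] this]
  show "solution (s3_par (\<alpha>1, \<alpha>2, \<alpha>3)) U (\<lambda>t. s3 (\<alpha>1, \<alpha>2, \<alpha>3) t (u t))"
    by (simp add: s3_par_def s3_eq_s3_adapted[OF assms])
qed

text \<open>The second component has the denominator \<open>f^2\<close> and the third has \<open>f\<close> and \<open>g\<close>, whence the
common denominator \<open>f^2 * g\<close>.\<close>

lemma s3_rational: "rational_on (ext_dom s3_dom) (ext_map (s3 \<alpha>))"
proof -
  obtain \<alpha>1 \<alpha>2 \<alpha>3 where \<alpha>: "\<alpha> = (\<alpha>1, \<alpha>2, \<alpha>3)" by (cases \<alpha>)
  define f where "f q = q $ 2 - (q $ 1)^2 - q $ 4 - q $ 5" for q :: ext_phase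
  define g where "g q = q $ 1 + q $ 3" for q :: ext_phase
  define n where "n q = q $ 1 * f q - g q * q $ 4 + \<alpha>1" for q
  define m where "m q = g q * (- 1 - g q * q $ 4 + 2 * \<alpha>1 + 2 * \<alpha>2)" for q
  define P where "P q = (vector
      [n q * f q * g q,
       (q $ 2 - (q $ 1)^2 - q $ 4) * (f q)^2 * g q + (n q)^2 * g q - m q * f q * g q,
       - ((f q)^3) - n q * f q * g q,
       - (m q * f q * g q)] :: phase)" for q
  have "\<forall>i. cpolynomial (\<lambda>q. P q $ i)" "cpolynomial (\<lambda>q. (f q)^2 * g q)"
    unfolding forall_4 P_def vector_4 f_def g_def n_def m_def
    by (intro conjI cpolynomial_intros)+
  moreover have "ext_dom s3_dom = {q. (f q)^2 * g q \<noteq> 0}"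
    by (auto simp: ext_dom_def s3_dom_def f3_def g3_def f_def g_def)
  moreover have "(vector [0, 1, 1, 0] :: phase) \<in> s3_dom 0"
    by (simp add: s3_dom_def f3_def g3_def)
  moreover have "\<forall>i. s3 \<alpha> (q $ 5) (phase_of q) $ i = P q $ i / ((f q)^2 * g q)"
    if "(f q)^2 * g q \<noteq> 0" for q
  proof -
    have "f3 (q $ 5) (phase_of q) = f q" "g3 (phase_of q) = g q"
      by (simp_all add: f3_def g3_def f_def g_def)
    then show ?thesis
      unfolding forall_4 \<alpha> s3_def split_conv Let_def P_def vector_4 phase_of_nth
      using that by (simp add: n_def m_def field_simps power2_eq_square power3_eq_cube)
  qed
  ultimately show ?thesis
    by (intro rational_on_ext_mapI[where P = P and Q = "\<lambda>q. (f q)^2 * g q"]) auto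
qed

lemma s3_s3:
  assumes "2 * \<alpha>1 + 2 * \<alpha>2 + \<alpha>3 = 1" "p \<in> s3_dom t"
  shows "s3 (- \<alpha>1 - \<alpha>3, 2 * \<alpha>1 + \<alpha>2 + \<alpha>3, \<alpha>3) t (s3 (\<alpha>1, \<alpha>2, \<alpha>3) t p) = p"
  using assms(2) by (simp add: s3_eq_s3_adapted[OF assms(1)] s3_eq_s3_adapted[OF normalized_s3_par[OF assms(1)]]
      s3_dom_iff s3_adapted_s3_adapted)

lemma s3_in_s3_dom:
  assumes "2 * \<alpha>1 + 2 * \<alpha>2 + \<alpha>3 = 1" "p \<in> s3_dom t"
  shows "s3 (\<alpha>1, \<alpha>2, \<alpha>3) t p \<in> s3_dom t"
  using assms(2) by (simp add: s3_eq_s3_adapted[OF assms(1)] s3_dom_iff s3_adapted_in_s3_adapted_dom)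

lemma s3_birational:
  assumes "2 * \<alpha>1 + 2 * \<alpha>2 + \<alpha>3 = 1"
  shows "birational_transformation s3_dom (s3 (\<alpha>1, \<alpha>2, \<alpha>3))"
proof (rule birational_transformationI[where G = "s3 (s3_par (\<alpha>1, \<alpha>2, \<alpha>3))"])
  note assms' = normalized_s3_par[OF assms]
  show "s3_dom t \<noteq> {}" for t
    using s3_dom_iff[of "adapted_inv t 1" t] by (auto simp: s3_adapted_dom_def)
  fix t p assume p: "p \<in> s3_dom t"
  show "s3 (\<alpha>1, \<alpha>2, \<alpha>3) t p \<in> s3_dom t"
    using assms p by (rule s3_in_s3_dom)
  show "s3 (s3_par (\<alpha>1, \<alpha>2, \<alpha>3)) t p \<in> s3_dom t"
    using s3_in_s3_dom[OF assms' p] by (simp add: s3_par_def)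
  show "s3 (s3_par (\<alpha>1, \<alpha>2, \<alpha>3)) t (s3 (\<alpha>1, \<alpha>2, \<alpha>3) t p) = p"
    using s3_s3[OF assms p] by (simp add: s3_par_def)
  show "s3 (\<alpha>1, \<alpha>2, \<alpha>3) t (s3 (s3_par (\<alpha>1, \<alpha>2, \<alpha>3)) t p) = p"
    using s3_s3[OF assms' p] by (simp add: s3_par_def)
qed (rule s3_rational)+

lemma s3_symplectic:
  assumes "2 * \<alpha>1 + 2 * \<alpha>2 + \<alpha>3 = 1"
  shows "symplectic_transformation s3_dom (s3 (\<alpha>1, \<alpha>2, \<alpha>3))"
  unfolding symplectic_transformation_def
proof
  fix t
  have "symplectic_on (s3_dom t) (adapted t)"
    using adapted_symplectic by (simp add: symplectic_on_def)
  from symplectic_on_comp[OF this s3_adapted_symplectic]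
  have "symplectic_on (s3_dom t) (\<lambda>p. s3_adapted \<alpha>1 \<alpha>3 (adapted t p))"
    by (simp add: s3_dom_iff)
  from symplectic_on_comp[OF this adapted_inv_symplectic[of t]]
  show "symplectic_on (s3_dom t) (s3 (\<alpha>1, \<alpha>2, \<alpha>3) t)"
    by (simp flip: s3_eq_s3_adapted[OF assms])
qed

theorem theorem2p1:
  fixes \<alpha>1 \<alpha>2 \<alpha>3 :: complex
  assumes "2 * \<alpha>1 + 2 * \<alpha>2 + \<alpha>3 = 1"
  shows "(invariant_under (\<alpha>1, \<alpha>2, \<alpha>3) s1_dom s1 s1_par \<and>
          birational_transformation s1_dom (s1 (\<alpha>1, \<alpha>2, \<alpha>3)) \<and> symplectic_transformation s1_dom (s1 (\<alpha>1, \<alpha>2, \<alpha>3))) \<and>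
         (invariant_under (\<alpha>1, \<alpha>2, \<alpha>3) s2_dom s2 s2_par \<and>
          birational_transformation s2_dom (s2 (\<alpha>1, \<alpha>2, \<alpha>3)) \<and> symplectic_transformation s2_dom (s2 (\<alpha>1, \<alpha>2, \<alpha>3))) \<and>
         (invariant_under (\<alpha>1, \<alpha>2, \<alpha>3) s3_dom s3 s3_par \<and>
          birational_transformation s3_dom (s3 (\<alpha>1, \<alpha>2, \<alpha>3)) \<and> symplectic_transformation s3_dom (s3 (\<alpha>1, \<alpha>2, \<alpha>3)))"
  using assms
  by (intro conjI s1_invariant s1_birational s1_symplectic s2_invariant s2_birational
      s2_symplectic s3_invariant s3_birational s3_symplectic)

end
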